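(* Let $n\ge 1$, let $q\ge 1$ be a real number and let $x_1,\dots,x_n$ be positive real numbers with $x_1+\cdots+x_n=1$. Let $\mathcal{T}_{\mathfrak{S}_n}(q,{\sf x})$ be the $q$-Tsetlin library on permutations (defined in the context). For $\pi\in\mathfrak{S}_n$ define \[ \Psi(q,{\sf x})_\pi=\frac{q^{-\mathrm{inv}(\pi)}}{\prod_{k=1}^{n-1}\left(\kappa(w_0;{\sf x})-q^{k-n-1}\kappa(\pi_1,\dots,\pi_{k-1};{\sf x})\right)}\times\left(\prod_{\substack{1\le k\le n-1\\ k\in \mathrm{LRM}(\pi)}}\kappa(\pi_k;{\sf x})\prod_{\substack{1\le k\le n-1\\ k\notin\mathrm{LRM}(\pi)}}\Big(\kappa(\pi_{p_k},\dots,\pi_k;{\sf x})-q^{-1}\kappa(\pi_{p_k},\dots,\pi_{k-1};{\sf x})\Big)\right), \] where $\kappa(w_0;{\sf x})=x_1+\cdots+x_n$. Then: (1) the row vector $\Psi(q,{\sf x})=(\Psi(q,{\sf x})_\pi)_{\pi\in\mathfrak{S}_n}$ is the stationary distribution of the $q$-Tsetlin library, i.e. $\Psi(q,{\sf x})\cdot\mathcal{T}_{\mathfrak{S}_n}(q,{\sf x})=(x_1+\cdots+x_n)\Psi(q,{\sf x})$; (2) each factor (in numerator and denominator) of $\Psi(q,{\sf x})_\pi$ is positive; (3) $\sum_{\pi\in\mathfrak{S}_n}\Psi(q,{\sf x})_\pi=1$.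
   Context: Permutations $\pi\in\mathfrak{S}_n$ are written in one-line notation $\pi=\pi_1\pi_2\cdots\pi_n$; for $1\le i\le n-1$, $\pi s_i$ denotes $\pi$ with the entries in positions $i$ and $i+1$ swapped. Let $V$ be the real vector space with basis $\mathfrak{S}_n$. The Hecke generators $T_1,\dots,T_{n-1}$ act on $V$ on the right by $\pi\cdot T_i=q\,\pi s_i$ if $\pi_{i+1}<\pi_i$, and $\pi\cdot T_i=\pi s_i+(q-1)\pi$ if $\pi_{i+1}>\pi_i$. Let $\mathcal{X}$ be the linear map $\pi\cdot\mathcal{X}=\frac{x_{\pi_1}}{q^{n-\pi_1}}\pi$. The $q$-Tsetlin library on permutations is the right operator $\mathcal{T}_{\mathfrak{S}_n}(q,{\sf x})=\sum_{i=1}^n T_{i-1}T_{i-2}\cdots T_1\,\mathcal{X}$, i.e. $\pi\cdot\mathcal{T}_{\mathfrak{S}_n}(q,{\sf x})=\sum_{i=1}^n\big((\cdots((\pi\cdot T_{i-1})\cdot T_{i-2})\cdots)\cdot T_1\big)\cdot\mathcal{X}$, where the $i=1$ term is $\pi\cdot\mathcal{X}$; its matrix (row $\pi$, column $\sigma$ = coefficient of $\sigma$ in $\pi\cdot\mathcal{T}_{\mathfrak{S}_n}(q,{\sf x})$) is the transition matrix of a Markov chain on $\mathfrak{S}_n$. For a weakly decreasing tuple ${\sf b}=(b_1,\dots,b_k)$ of elements of $[n]$, $\kappa({\sf b};{\sf x})=\sum_{i=1}^k x_{b_i}q^{i+b_i-k-1}$; for an arbitrary tuple, $\kappa({\sf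 b};{\sf x})$ is $\kappa$ of its weakly decreasing rearrangement; the empty tuple gives $0$; $w_0=n\,(n-1)\cdots 1$. A position $j$ is a left-to-right minimum of $\pi$ if $\pi_i>\pi_j$ for all $i<j$; $\mathrm{LRM}(\pi)$ is the set of such positions. For $k\notin\mathrm{LRM}(\pi)$, $p_k$ is the smallest position $i<k$ with $\pi_i<\pi_k$. $\mathrm{inv}(\pi)$ is the number of pairs $i<j$ with $\pi_i>\pi_j$. *)

theory Defs
  imports Complex_Main "HOL-Combinatorics.Permutations"
begin

text \<open>
  A permutation of \<open>{1..n}\<close> is a function \<open>\<pi>\<close> with \<open>\<pi> permutes {1..n}\<close>; its one-line notation
  is \<open>\<pi> 1, ..., \<pi> n\<close>. Such a \<open>\<pi>\<close> fixes every number outside \<open>{1..n}\<close>, in particular \<open>0\<close>, so all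
  positions below are explicitly bounded from below by \<open>1\<close>.
\<close>

abbreviation perms :: "nat \<Rightarrow> (nat \<Rightarrow> nat) set" where
  "perms n \<equiv> {\<pi>. \<pi> permutes {1..n}}"

definition swap_pos :: "nat \<Rightarrow> (nat \<Rightarrow> nat) \<Rightarrow> (nat \<Rightarrow> nat)" where
  "swap_pos i \<pi> = \<pi> \<circ> transpose i (i + 1)"


text \<open>
  A vector of the space with basis \<open>perms n\<close> is given by its coefficient function; only the
  coefficients at elements of \<open>perms n\<close> are meaningful. \<open>lin_ext n f\<close> is the linear extension of a
  map \<open>f\<close> given on the basis.
\<close>

type_synonym vec = "(nat \<Rightarrow> nat) \<Rightarrow> real"

definition basis_vec :: "(nat \<Rightarrow> nat) \<Rightarrow> vec" where
  "basis_vec \<pi> = (\<lambda>\<sigma>. if \<sigma> = \<pi> then 1 else 0)"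

definition lin_ext :: "nat \<Rightarrow> ((nat \<Rightarrow> nat) \<Rightarrow> vec) \<Rightarrow> vec \<Rightarrow> vec" where
  "lin_ext n f v = (\<lambda>\<sigma>. \<Sum>\<pi>\<in>perms n. v \<pi> * f \<pi> \<sigma>)"

definition hecke_T :: "nat \<Rightarrow> real \<Rightarrow> nat \<Rightarrow> vec \<Rightarrow> vec" where
  "hecke_T n q i = lin_ext n (\<lambda>\<pi>.
     if \<pi> (i + 1) < \<pi> i then (\<lambda>\<sigma>. q * basis_vec (swap_pos i \<pi>) \<sigma>)
     else (\<lambda>\<sigma>. basis_vec (swap_pos i \<pi>) \<sigma> + (q - 1) * basis_vec \<pi> \<sigma>))"

definition X_op :: "nat \<Rightarrow> real \<Rightarrow> (nat \<Rightarrow> real) \<Rightarrow> vec \<Rightarrow> vec" where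
  "X_op n q x = lin_ext n (\<lambda>\<pi> \<sigma>. x (\<pi> 1) / q ^ (n - \<pi> 1) * basis_vec \<pi> \<sigma>)"

text \<open>
  Operators act on the right: \<open>rev [1..<i]\<close> is \<open>[i - 1, ..., 1]\<close>, and \<open>fold\<close> applies \<open>T\<^bsub>i-1\<^esub>\<close> first and
  \<open>T\<^bsub>1\<^esub>\<close> last.
\<close>

definition tsetlin :: "nat \<Rightarrow> real \<Rightarrow> (nat \<Rightarrow> real) \<Rightarrow> vec \<Rightarrow> vec" where
  "tsetlin n q x v = (\<lambda>\<sigma>. \<Sum>i=1..n. X_op n q x (fold (hecke_T n q) (rev [1..<i]) v) \<sigma>)"

definition tsetlin_matrix :: "nat \<Rightarrow> real \<Rightarrow> (nat \<Rightarrow> real) \<Rightarrow> (nat \<Rightarrow> nat) \<Rightarrow> (nat \<Rightarrow> nat) \<Rightarrow> real" where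
  "tsetlin_matrix n q x \<pi> \<sigma> = tsetlin n q x (basis_vec \<pi>) \<sigma>"


text \<open>Tuples are lists, so the entry \<open>b\<^sub>i\<close> is \<open>b ! (i - 1)\<close>. The exponents can be negative.\<close>

definition kappa_decr :: "real \<Rightarrow> (nat \<Rightarrow> real) \<Rightarrow> nat list \<Rightarrow> real" where
  "kappa_decr q x b =
     (\<Sum>i=1..length b. x (b ! (i - 1)) * q powi (int i + int (b ! (i - 1)) - int (length b) - 1))"

definition kappa :: "real \<Rightarrow> (nat \<Rightarrow> real) \<Rightarrow> nat list \<Rightarrow> real" where
  "kappa q x b = kappa_decr q x (rev (sort b))"

definition w0 :: "nat \<Rightarrow> nat list" where
  "w0 n = rev [1..<n + 1]"

lemma kappa_w0: "kappa q x (w0 n) = (\<Sum>i=1..n. x i)"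
proof -
  have sort_w0: "sort (w0 n) = [1..<n + 1]"
    unfolding w0_def by (rule properties_for_sort) (simp_all del: upt_Suc)
  have "kappa q x (w0 n) = (\<Sum>i=1..n. x (n + 1 - i))"
    unfolding kappa_def kappa_decr_def sort_w0
    by (intro sum.cong) (auto simp: rev_nth Suc_diff_le simp del: upt_Suc)
  also have "\<dots> = (\<Sum>i=1..n. x i)"
    by (rule sum.reindex_bij_witness[of _ "\<lambda>i. n + 1 - i" "\<lambda>i. n + 1 - i"]) auto
  finally show ?thesis .
qed


text \<open>\<open>entries \<pi> a b\<close> is the tuple of the entries in positions \<open>a, ..., b - 1\<close>.\<close>

definition entries :: "(nat \<Rightarrow> nat) \<Rightarrow> nat \<Rightarrow> nat \<Rightarrow> nat list" where
  "entries \<pi> a b = map \<pi> [a..<b]"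

definition LRM :: "nat \<Rightarrow> (nat \<Rightarrow> nat) \<Rightarrow> nat set" where
  "LRM n \<pi> = {j \<in> {1..n}. \<forall>i\<in>{1..<j}. \<pi> i > \<pi> j}"

text \<open>Meaningful for \<open>k \<in> {1..n} - LRM n \<pi>\<close>, where such a position exists.\<close>

definition first_smaller :: "(nat \<Rightarrow> nat) \<Rightarrow> nat \<Rightarrow> nat" where
  "first_smaller \<pi> k = (LEAST i. 1 \<le> i \<and> i < k \<and> \<pi> i < \<pi> k)"

definition inv_count :: "nat \<Rightarrow> (nat \<Rightarrow> nat) \<Rightarrow> nat" where
  "inv_count n \<pi> = card {(i, j). 1 \<le> i \<and> i < j \<and> j \<le> n \<and> \<pi> i > \<pi> j}"


definition denom_factor :: "nat \<Rightarrow> real \<Rightarrow> (nat \<Rightarrow> real) \<Rightarrow> (nat \<Rightarrow> nat) \<Rightarrow> nat \<Rightarrow> real" where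
  "denom_factor n q x \<pi> k =
     kappa q x (w0 n) - q powi (int k - int n - 1) * kappa q x (entries \<pi> 1 k)"

definition non_LRM_factor :: "real \<Rightarrow> (nat \<Rightarrow> real) \<Rightarrow> (nat \<Rightarrow> nat) \<Rightarrow> nat \<Rightarrow> real" where
  "non_LRM_factor q x \<pi> k =
     kappa q x (entries \<pi> (first_smaller \<pi> k) (k + 1))
       - inverse q * kappa q x (entries \<pi> (first_smaller \<pi> k) k)"

definition Psi :: "nat \<Rightarrow> real \<Rightarrow> (nat \<Rightarrow> real) \<Rightarrow> (nat \<Rightarrow> nat) \<Rightarrow> real" where
  "Psi n q x \<pi> =
     q powi (- int (inv_count n \<pi>)) / (\<Prod>k=1..n - 1. denom_factor n q x \<pi> k)
     * ((\<Prod>k \<in> {1..n - 1} \<inter> LRM n \<pi>. kappa q x [\<pi> k])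
        * (\<Prod>k \<in> {1..n - 1} - LRM n \<pi>. non_LRM_factor q x \<pi> k))"

end

(* For a set P of letters, kappa depends only on P; write K(P). The numerator factors are all of
   the form K(P + a) - K(P)/q, where P is the set of letters before a (for a non-LRM letter, the
   letters before the first smaller one exceed a and cancel out). Hence Psi is the law of a sequential
   sampling: given the set P of letters already written, the next letter is a with probability
   w(P, a) = q^(-r) (K(P + a) - K(P)/q) / (1 - q^(|P| - n) K(P)), where r is the number of unused
   letters below a. These probabilities add up to 1 for fixed P, which gives (3).

   For (1), let Phi_j (tail_vec j) be the sum of Psi T_(i-1) ... T_j over i >= j, so that Phi_n = Psi and
   Phi_j = Psi + Phi_(j+1) T_j. Downward induction shows that Phi_j arises from the product formula
   for Psi by replacing its factor w(P_j, pi_j) by q^(n-j-r); then Phi_1 X = Psi by inspection. *)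

theory Submission
  imports Defs "HOL-Combinatorics.Multiset_Permutations"
begin

section \<open>Weights of letter sets and the numerator factors\<close>

locale q_tsetlin =
  fixes n :: nat and q :: real and x :: "nat \<Rightarrow> real"
  assumes n_pos: "n \<ge> 1" and q_ge_1: "q \<ge> 1"
    and x_pos: "\<And>i. i \<in> {1..n} \<Longrightarrow> x i > 0"
    and x_sum: "(\<Sum>i=1..n. x i) = 1"
begin

lemma q_pos: "q > 0"
  using q_ge_1 by simp

text \<open>In a strictly decreasing tuple of length k exactly k - i entries are smaller than b_i,
  so the exponent i + b_i - k - 1 of \<open>kappa_decr\<close> is b_i - 1 minus a rank. Written
  through the rank, it needs no ordering of the letters.\<close>

definition term_wt :: "nat set \<Rightarrow> nat \<Rightarrow> real" where
  "term_wt P b = x b * q powi (int b - 1 - int (card {c\<in>P. c < b}))"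

definition kappa_set :: "nat set \<Rightarrow> real" where
  "kappa_set P = (\<Sum>b\<in>P. term_wt P b)"

definition num_factor :: "nat set \<Rightarrow> nat \<Rightarrow> real" where
  "num_factor P a = kappa_set (insert a P) - kappa_set P / q"

definition den_factor :: "nat set \<Rightarrow> real" where
  "den_factor P = 1 - q powi (int (card P) - int n) * kappa_set P"

definition free_rank :: "nat set \<Rightarrow> nat \<Rightarrow> nat" where
  "free_rank P a = card {b \<in> {1..n} - P. b < a}"

definition step_prob :: "nat set \<Rightarrow> nat \<Rightarrow> real" where
  "step_prob P a = num_factor P a / (q ^ free_rank P a * den_factor P)"

text \<open>Inserting \<open>a\<close> keeps the weights of the letters below \<open>a\<close> and
  divides those above \<open>a\<close> by q. Hence in K(P + a) - K(P)/q the letters above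
  \<open>a\<close> cancel, and those below survive with coefficient 1 - 1/q.\<close>

lemma num_factor_eq:
  assumes "finite P" "a \<notin> P"
  shows "num_factor P a = term_wt P a + (1 - 1 / q) * (\<Sum>c\<in>{c\<in>P. c < a}. term_wt P c)"
proof -
  let ?L = "{c\<in>P. c < a}" and ?G = "{c\<in>P. c > a}"
  have P: "P = ?L \<union> ?G" using assms(2) by auto (metis nat_neq_iff)
  have sumP: "sum g P = sum g ?L + sum g ?G" for g :: "nat \<Rightarrow> real"
    by (subst P, rule sum.union_disjoint) (use assms(1) in auto)
  have "{c \<in> insert a P. c < a} = ?L" by auto
  then have self: "term_wt (insert a P) a = term_wt P a"
    by (simp add: term_wt_def)
  have low: "term_wt (insert a P) c = term_wt P c" if "c \<in> ?L" for c
  proof -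
    have "{b \<in> insert a P. b < c} = {b \<in> P. b < c}" using that by auto
    then show ?thesis by (simp add: term_wt_def)
  qed
  have high: "term_wt (insert a P) c = term_wt P c / q" if "c \<in> ?G" for c
  proof -
    have "{b \<in> insert a P. b < c} = insert a {b \<in> P. b < c}" using that by auto
    then have "card {b \<in> insert a P. b < c} = Suc (card {b \<in> P. b < c})"
      using assms by simp
    then have "int c - 1 - int (card {b \<in> insert a P. b < c})
        = (int c - 1 - int (card {b \<in> P. b < c})) - 1"
      by simp
    moreover have "q powi (k - 1) = q powi k / q" for k
      using q_pos by (simp add: power_int_diff)
    ultimately show ?thesis
      by (simp only: term_wt_def times_divide_eq_right)
  qed
  have "kappa_set (insert a P) = term_wt (insert a P) a + (\<Sum>c\<in>P. term_wt (insert a P) c)"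
    unfolding kappa_set_def using assms by simp
  also have "\<dots> = term_wt P a + (\<Sum>c\<in>?L. term_wt P c) + (\<Sum>c\<in>?G. term_wt P c) / q"
    unfolding sumP self using low high by (simp add: sum_divide_distrib)
  finally show ?thesis
    unfolding num_factor_def by (simp add: kappa_set_def sumP algebra_simps add_divide_distrib)
qed

text \<open>By \<open>num_factor_eq\<close> only the letters below \<open>a\<close> enter. This
  allows the window starting at \<open>first_smaller\<close> to be exchanged for the whole prefix,
  and the empty set for the prefix of a left-to-right minimum.\<close>

lemma num_factor_below:
  assumes "finite P" "finite Q" "a \<notin> P" "a \<notin> Q" "{c\<in>P. c < a} = {c\<in>Q. c < a}"
  shows "num_factor P a = num_factor Q a"
proof -
  have wt: "term_wt P c = term_wt Q c" if "c \<le> a" for c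
  proof -
    have "b \<in> P \<longleftrightarrow> b \<in> Q" if "b < a" for b using assms(5) that by blast
    then have "{b\<in>P. b < c} = {b\<in>Q. b < c}"
      using that by (meson less_le_trans)
    then show ?thesis by (simp only: term_wt_def)
  qed
  show ?thesis
    unfolding num_factor_eq[OF assms(1,3)] num_factor_eq[OF assms(2,4)] assms(5)
    by (simp add: wt)
qed

lemma num_factor_insert_greater:
  assumes "finite P" "a \<notin> P" "b < a" "b \<notin> P"
  shows "num_factor (insert a P) b = num_factor P b"
  using assms by (intro num_factor_below) auto

text \<open>K(P + a + b) can be expanded along either order of insertion; when the larger letter
  \<open>b\<close> comes first, the factor of \<open>a\<close> is unchanged. Comparing the two
  expansions gives the relation.\<close>

lemma num_factor_insert_less:
  assumes "finite P" "a \<notin> P" "a < b" "b \<notin> P"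
  shows "q * num_factor (insert a P) b = num_factor P b + (q - 1) * num_factor P a"
proof -
  have "num_factor (insert b P) a = num_factor P a"
    using assms by (intro num_factor_insert_greater) auto
  then have "q * kappa_set (insert a (insert b P))
      = kappa_set (insert b P) + q * kappa_set (insert a P) - kappa_set P"
    using q_pos by (simp add: num_factor_def field_simps)
  then show ?thesis
    using q_pos by (simp add: num_factor_def insert_commute[of a b] algebra_simps diff_divide_distrib)
qed

lemma num_factor_pos:
  assumes "P \<subseteq> {1..n}" "a \<in> {1..n}" "a \<notin> P"
  shows "num_factor P a > 0"
proof -
  have pos: "term_wt P c > 0" if "c \<in> {1..n}" for c
    using x_pos[OF that] q_pos by (simp add: term_wt_def)
  have "(\<Sum>c\<in>{c\<in>P. c < a}. term_wt P c) \<ge> 0"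
    using assms(1) by (intro sum_nonneg less_imp_le pos) auto
  moreover have "1 - 1 / q \<ge> 0" using q_ge_1 by simp
  ultimately show ?thesis
    using assms finite_subset[OF assms(1)] pos[OF assms(2)]
    by (simp add: num_factor_eq add_pos_nonneg)
qed

section \<open>Denominator factors\<close>

lemma den_factor_diff:
  assumes "finite P" "a \<notin> P"
  shows "den_factor P - den_factor (insert a P) = q powi (int (card P) + 1 - int n) * num_factor P a"
proof -
  have "q powi (int (card P) + 1 - int n) = q * q powi (int (card P) - int n)"
    using q_pos by (simp add: power_int_diff power_int_add)
  then show ?thesis
    using assms q_pos by (simp add: den_factor_def num_factor_def algebra_simps)
qed

lemma kappa_set_full: "kappa_set {1..n} = 1"
proof -
  have wt: "term_wt {1..n} b = x b" if "b \<in> {1..n}" for b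
  proof -
    have "{c \<in> {1..n}. c < b} = {1..<b}" using that by auto
    then show ?thesis using that by (simp add: term_wt_def)
  qed
  have "kappa_set {1..n} = (\<Sum>b=1..n. x b)"
    unfolding kappa_set_def by (rule sum.cong[OF refl wt])
  then show ?thesis using x_sum by simp
qed

lemma den_factor_full: "den_factor {1..n} = 0"
  using kappa_set_full by (simp add: den_factor_def)

text \<open>With one letter missing, the power of q in \<open>den_factor_diff\<close> is 1 and the
  factor of the full set is 0. This is why the products in \<open>Psi\<close> may stop at n -
  1.\<close>

lemma den_factor_last:
  assumes "insert a P = {1..n}" "a \<notin> P"
  shows "den_factor P = num_factor P a"
proof -
  have fin: "finite P" using assms(1) by (metis finite_atLeastAtMost finite_insert)
  have "card P + 1 = n" using assms fin by (metis card_atLeastAtMost card_insert_disjoint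
        Suc_eq_plus1 diff_Suc_1)
  then show ?thesis
    using den_factor_diff[OF fin assms(2)] unfolding assms(1) den_factor_full by auto
qed

text \<open>Downward induction from the full set, where the factor is 0: by
  \<open>den_factor_diff\<close> each removed letter adds a positive amount.\<close>

lemma den_factor_pos:
  assumes "P \<subset> {1..n}"
  shows "den_factor P > 0"
  using assms
proof (induction "card ({1..n} - P)" arbitrary: P rule: less_induct)
  case less
  obtain a where a: "a \<in> {1..n}" "a \<notin> P" using less.prems by blast
  have fin: "finite P" using less.prems by (meson finite_atLeastAtMost finite_subset psubset_imp_subset)
  have "den_factor (insert a P) \<ge> 0"
  \<comment> \<open>The induction hypothesis speaks of proper subsets only; the full set supplies
    the boundary value 0.\<close>
  proof (cases "insert a P = {1..n}")
    case True
    then show ?thesis using den_factor_full by (simp only:)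
  next
    case False
    have "{1..n} - insert a P \<subset> {1..n} - P" using a by blast
    then have "card ({1..n} - insert a P) < card ({1..n} - P)"
      by (rule psubset_card_mono[OF finite_Diff[OF finite_atLeastAtMost]])
    moreover have "insert a P \<subset> {1..n}" using False a less.prems by blast
    ultimately show ?thesis by (intro less_imp_le less.hyps)
  qed
  moreover have "q powi (int (card P) + 1 - int n) * num_factor P a > 0"
    using num_factor_pos[OF psubset_imp_subset[OF less.prems] a] q_pos by simp
  ultimately show ?case using den_factor_diff[OF fin a(2)] by linarith
qed

section \<open>The one-step probabilities add up to 1\<close>

lemma sum_inverse_power_rank:
  fixes R :: "nat set"
  assumes "finite R"
  shows "(1 - 1 / q) * (\<Sum>a\<in>R. 1 / q ^ card {b\<in>R. b < a}) = 1 - 1 / q ^ card R"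
  using assms
proof (induction R rule: finite_linorder_max_induct)
  case (insert m R)
  \<comment> \<open>\<open>m\<close> exceeds all of \<open>R\<close>, so its rank is
    \<open>card R\<close> and the other ranks stay: the ranks run through 0, 1, 2, ... and the sum
    is geometric. Keeping 1 - 1/q as a factor on the left covers q = 1 as well.\<close>
  have "{b \<in> insert m R. b < m} = R" using insert by auto
  moreover have "{b \<in> insert m R. b < a} = {b \<in> R. b < a}" if "a \<in> R" for a
    using insert that by auto
  moreover have "m \<notin> R" using insert by auto
  ultimately have "(1 - 1 / q) * (\<Sum>a\<in>insert m R. 1 / q ^ card {b \<in> insert m R. b < a})
      = (1 - 1 / q) / q ^ card R + (1 - 1 / q ^ card R)"
    using insert by (simp add: distrib_left)
  also have "\<dots> = 1 - 1 / q ^ card (insert m R)"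
    using insert \<open>m \<notin> R\<close> q_pos by (simp add: field_simps)
  finally show ?case .
qed simp

lemma sum_num_factor:
  assumes "P \<subseteq> {1..n}"
  shows "(\<Sum>a\<in>{1..n} - P. num_factor P a / q ^ free_rank P a) = den_factor P"
proof -
  let ?R = "{1..n} - P"
  have fin: "finite P" using assms finite_subset by blast
  have term_wt: "term_wt P a = x a * q ^ free_rank P a" if "a \<in> {1..n}" for a
  proof -
    have "{1..<a} = {b\<in>?R. b < a} \<union> {c\<in>P. c < a}" using that assms by auto
    then have "card {1..<a} = card {b\<in>?R. b < a} + card {c\<in>P. c < a}"
      using fin by (simp only:) (rule card_Un_disjoint, auto)
    then have "int a - 1 - int (card {c\<in>P. c < a}) = int (free_rank P a)"
      using that unfolding free_rank_def by auto
    then show ?thesis by (simp add: term_wt_def)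
  qed
  have tail: "(1 - 1 / q) * (\<Sum>a\<in>{a\<in>?R. c < a}. 1 / q ^ free_rank P a)
      = 1 / q ^ free_rank P c - 1 / q ^ card ?R" if "c \<in> P" for c
  proof -
    let ?L = "{a\<in>?R. a < c}"
    have R: "?R = ?L \<union> {a\<in>?R. c < a}" using that by auto (metis nat_neq_iff)
    have "(\<Sum>a\<in>?R. 1 / q ^ free_rank P a)
        = (\<Sum>a\<in>?L. 1 / q ^ free_rank P a) + (\<Sum>a\<in>{a\<in>?R. c < a}. 1 / q ^ free_rank P a)"
      by (subst R, rule sum.union_disjoint) auto
    moreover have "(\<Sum>a\<in>?L. 1 / q ^ free_rank P a) = (\<Sum>a\<in>?L. 1 / q ^ card {b\<in>?L. b < a})"
      by (intro sum.cong refl arg_cong[where f = "\<lambda>k. 1 / q ^ k"])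
        (auto simp: free_rank_def intro: arg_cong[where f = card])
    ultimately have "(1 - 1 / q) * (\<Sum>a\<in>{a\<in>?R. c < a}. 1 / q ^ free_rank P a)
      = (1 - 1 / q) * (\<Sum>a\<in>?R. 1 / q ^ card {b\<in>?R. b < a})
      - (1 - 1 / q) * (\<Sum>a\<in>?L. 1 / q ^ card {b\<in>?L. b < a})"
      by (simp add: free_rank_def algebra_simps)
    then show ?thesis
      by (subst (asm) (1 2) sum_inverse_power_rank) (auto simp: free_rank_def)
  qed
  have "(\<Sum>a\<in>?R. num_factor P a / q ^ free_rank P a)
      = (\<Sum>a\<in>?R. x a + (1 - 1 / q) * (\<Sum>c\<in>{c\<in>P. c < a}. term_wt P c / q ^ free_rank P a))"
    using fin q_pos
    by (intro sum.cong refl)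
      (simp add: num_factor_eq term_wt add_divide_distrib flip: sum_divide_distrib)
  also have "\<dots> = (\<Sum>a\<in>?R. x a)
      + (1 - 1 / q) * (\<Sum>a\<in>?R. \<Sum>c\<in>{c\<in>P. c < a}. term_wt P c / q ^ free_rank P a)"
    by (simp add: sum.distrib sum_distrib_left)
  also have "(\<Sum>a\<in>?R. \<Sum>c\<in>{c\<in>P. c < a}. term_wt P c / q ^ free_rank P a)
      = (\<Sum>c\<in>P. \<Sum>a\<in>{a\<in>?R. c < a}. term_wt P c / q ^ free_rank P a)"
    by (rule sum.swap_restrict) (use fin in auto)
  also have "(1 - 1 / q) * \<dots>
      = (\<Sum>c\<in>P. term_wt P c * ((1 - 1 / q) * (\<Sum>a\<in>{a\<in>?R. c < a}. 1 / q ^ free_rank P a)))"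
    by (simp add: sum_distrib_left algebra_simps)
  also have "\<dots> = (\<Sum>c\<in>P. x c - term_wt P c / q ^ card ?R)"
    using q_pos assms
    by (intro sum.cong refl, subst tail) (auto simp: term_wt subset_iff field_simps)
  also have "\<dots> = (\<Sum>c\<in>P. x c) - kappa_set P / q ^ card ?R"
    by (simp add: kappa_set_def sum_subtractf sum_divide_distrib)
  also have "(\<Sum>a\<in>?R. x a) + ((\<Sum>c\<in>P. x c) - kappa_set P / q ^ card ?R)
      = 1 - kappa_set P / q ^ card ?R"
    using sum.subset_diff[OF assms, of x] x_sum by simp
  also have "\<dots> = den_factor P"
  proof -
    have "card P \<le> n" using card_mono[OF _ assms] by simp
    then have "int (card P) - int n = - int (card ?R)"
      using assms fin by (simp add: card_Diff_subset)
    then show ?thesis by (simp add: den_factor_def power_int_minus divide_inverse)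
  qed
  finally show ?thesis .
qed

lemma sum_step_prob:
  assumes "P \<subset> {1..n}"
  shows "(\<Sum>a\<in>{1..n} - P. step_prob P a) = 1"
proof -
  have "(\<Sum>a\<in>{1..n} - P. step_prob P a)
      = (\<Sum>a\<in>{1..n} - P. num_factor P a / q ^ free_rank P a) / den_factor P"
    by (simp add: step_prob_def sum_divide_distrib)
  then show ?thesis
    using sum_num_factor[of P] den_factor_pos[OF assms] assms by auto
qed

section \<open>Exchange of two neighbouring letters\<close>

lemma free_rank_insert_less:
  assumes "b < a" "b \<in> {1..n}" "b \<notin> P"
  shows "free_rank P a = Suc (free_rank (insert b P) a)"
proof -
  have "{c \<in> {1..n} - P. c < a} = insert b {c \<in> {1..n} - insert b P. c < a}"
    using assms by auto
  then show ?thesis by (simp add: free_rank_def)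
qed

lemma free_rank_insert_greater:
  assumes "b < a"
  shows "free_rank (insert a P) b = free_rank P b"
  unfolding free_rank_def using assms by (intro arg_cong[where f = card]) auto

text \<open>This is Phi_j = Psi + Phi_(j+1) T_j at one permutation, stripped of the common factors:
  \<open>P\<close> is the prefix before position j, \<open>a\<close> and \<open>b\<close> are the
  letters at j and j + 1, and \<open>m\<close> is n - j - 1. In Phi_(j+1) position j + 1 has lost
  its probability, so the denominator of \<open>insert b P\<close> never enters.\<close>

lemma step_prob_swap:
  assumes P: "P \<subseteq> {1..n}" and m: "card P + Suc (Suc m) = n"
    and a: "a \<in> {1..n}" "a \<notin> P" and b: "b \<in> {1..n}" "b \<notin> P" and ab: "a \<noteq> b"
  shows "q ^ Suc m / q ^ free_rank P a * step_prob (insert a P) b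
    = step_prob P a * step_prob (insert a P) b
      + (if a < b then q * (q ^ m / q ^ free_rank (insert b P) a * step_prob P b)
            + (q - 1) * (q ^ m / q ^ free_rank (insert a P) b * step_prob P a)
         else q ^ m / q ^ free_rank (insert b P) a * step_prob P b)"
proof -
  have fin: "finite P" using P finite_subset by blast
  define D where "D = den_factor P"
  define D' where "D' = den_factor (insert a P)"
  define R where "R = q ^ free_rank (insert b P) a"
  define S where "S = q ^ free_rank (insert a P) b"
  define A where "A = num_factor P a"
  define B where "B = num_factor P b"
  define B' where "B' = num_factor (insert a P) b"
  have "D > 0" unfolding D_def using P a by (intro den_factor_pos) blast
  moreover have "D' > 0"
    unfolding D'_def
  proof (intro den_factor_pos psubsetI)
    show "insert a P \<subseteq> {1..n}" using P a(1) by blast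
    show "insert a P \<noteq> {1..n}" using b ab by (metis insertE)
  qed
  ultimately have nz: "R \<noteq> 0" "S \<noteq> 0" "D \<noteq> 0" "D' \<noteq> 0" "q \<noteq> 0"
    using q_pos by (simp_all add: R_def S_def)
  have "int (card P) + 1 - int n = - int (Suc m)" using m by linarith
  then have "D - D' = A / q ^ Suc m"
    using den_factor_diff[OF fin a(2)]
    by (simp only: D_def D'_def A_def power_int_minus power_int_of_nat) (simp add: divide_inverse)
  \<comment> \<open>Replacing \<open>A\<close> by the difference of the two denominators leaves a
    rational identity; the relation between \<open>B\<close> and \<open>B'\<close> that it still
    needs depends on which letter is larger.\<close>
  then have A: "A = q * q ^ m * (D - D')"
    using nz by simp
  show ?thesis
  proof (cases "a < b")
    case True
    have rank: "q ^ free_rank P a = R" "q ^ free_rank P b = q * S"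
      using True a free_rank_insert_less[of a b P] free_rank_insert_greater[of a b P]
      by (simp_all add: R_def S_def)
    have B: "B + (q - 1) * A = q * B'"
      using num_factor_insert_less[OF fin a(2) True b(2)] by (simp add: A_def B_def B'_def)
    have "q * (q ^ m / R * (B / (q * S * D))) + (q - 1) * (q ^ m / S * (A / (R * D)))
        = q ^ m * (B + (q - 1) * A) / (R * S * D)"
      using nz by (simp add: divide_simps) (simp add: algebra_simps)
    then have "q * q ^ m / R * (B' / (S * D')) = A / (R * D) * (B' / (S * D'))
        + (q * (q ^ m / R * (B / (q * S * D))) + (q - 1) * (q ^ m / S * (A / (R * D))))"
      unfolding B unfolding A using nz by (simp add: divide_simps) (simp add: algebra_simps)
    then show ?thesis
      using True unfolding step_prob_def
      by (simp only: rank power_Suc if_True flip: D_def D'_def R_def S_def A_def B_def B'_def)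
  next
    case False
    then have ba: "b < a" using ab by simp
    have rank: "q ^ free_rank P a = q * R" "q ^ free_rank P b = S"
      using ba b free_rank_insert_less[of b a P] free_rank_insert_greater[of b a P]
      by (simp_all add: R_def S_def)
    have B: "B' = B"
      using num_factor_insert_greater[OF fin a(2) ba b(2)] by (simp add: B_def B'_def)
    have "q * q ^ m / (q * R) * (B' / (S * D'))
        = A / (q * R * D) * (B' / (S * D')) + q ^ m / R * (B / (S * D))"
      unfolding A B using nz by (simp add: divide_simps) (simp add: algebra_simps)
    then show ?thesis
      using False unfolding step_prob_def
      by (simp only: rank power_Suc if_False flip: D_def D'_def R_def S_def A_def B_def B'_def)
  qed
qed

section \<open>From tuples to letter sets\<close>

lemma kappa_set_insert_max:
  assumes "finite P" "\<And>c. c \<in> P \<Longrightarrow> c < a"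
  shows "kappa_set (insert a P) = x a * q powi (int a - 1 - int (card P)) + kappa_set P"
proof -
  have "a \<notin> P" using assms(2) by blast
  have "{c \<in> insert a P. c < a} = P" using assms(2) by auto
  moreover have low: "term_wt (insert a P) c = term_wt P c" if "c \<in> P" for c
  proof -
    have "{b \<in> insert a P. b < c} = {b \<in> P. b < c}" using that assms(2)[of c] by auto
    then show ?thesis by (simp add: term_wt_def)
  qed
  moreover have "kappa_set (insert a P) = term_wt (insert a P) a + kappa_set P"
    unfolding kappa_set_def using assms(1) \<open>a \<notin> P\<close> by (simp add: low)
  ultimately show ?thesis by (simp add: term_wt_def)
qed

text \<open>The exponents effectively count positions from the end, so prepending a larger letter
  leaves the terms of the tail alone and adds the term of a new maximum.\<close>

lemma kappa_decr_eq:
  assumes "sorted_wrt (>) b"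
  shows "kappa_decr q x b = kappa_set (set b)"
  using assms
proof (induction b)
  case Nil
  then show ?case by (simp add: kappa_decr_def kappa_set_def)
next
  case (Cons a b)
  have unfold: "kappa_decr q x c
      = (\<Sum>k<length c. x (c ! k) * q powi (int k + int (c ! k) - int (length c)))" for c
    by (simp add: kappa_decr_def sum.atLeast1_atMost_eq add_diff_eq)
  have "distinct b"
    using Cons.prems strict_sorted_iff[of "rev b"] by (simp add: sorted_wrt_rev)
  have "kappa_decr q x (a # b) = x a * q powi (int a - 1 - int (length b)) + kappa_decr q x b"
    unfolding unfold by (simp add: sum.lessThan_Suc_shift diff_diff_eq add_diff_eq del: sum.lessThan_Suc)
  then show ?case
    using Cons \<open>distinct b\<close> by (simp add: kappa_set_insert_max distinct_card)
qed

lemma kappa_eq: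
  assumes "distinct xs"
  shows "kappa q x xs = kappa_set (set xs)"
proof -
  have "sorted_wrt (>) (rev (sort xs))"
    using assms by (simp add: sorted_wrt_rev strict_sorted_iff)
  then show ?thesis by (simp add: kappa_def kappa_decr_eq)
qed

section \<open>\<open>Psi\<close> as a product of step probabilities\<close>

context
  fixes \<pi> :: "nat \<Rightarrow> nat"
  assumes perm: "\<pi> permutes {1..n}"
begin

lemma inj_perm: "inj_on \<pi> A"
  using permutes_inj[OF perm] by (rule inj_on_subset) simp

lemma perm_in: "\<pi> k \<in> {1..n} \<longleftrightarrow> k \<in> {1..n}"
  using permutes_in_image[OF perm] .

lemma perm_notin_prefix: "\<pi> k \<notin> \<pi> ` {1..<k}"
  using injD[OF permutes_inj[OF perm]] by fastforce

lemma prefix_subset: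
  assumes "k \<in> {1..n}"
  shows "\<pi> ` {1..<k} \<subset> {1..n}"
proof
  show "\<pi> ` {1..<k} \<subseteq> {1..n}" using assms perm_in by fastforce
  show "\<pi> ` {1..<k} \<noteq> {1..n}" using perm_in[of k] assms perm_notin_prefix[of k] by metis
qed

lemma card_prefix: "card (\<pi> ` {1..<k}) = k - 1"
  by (simp add: card_image[OF inj_perm])

lemma prefix_Suc:
  assumes "k \<ge> 1"
  shows "\<pi> ` {1..<Suc k} = insert (\<pi> k) (\<pi> ` {1..<k})"
  using assms by (simp add: atLeastLessThanSuc)

lemma kappa_entries: "kappa q x (entries \<pi> i k) = kappa_set (\<pi> ` {i..<k})"
  by (simp add: kappa_eq entries_def distinct_map inj_perm)

lemma denom_factor_eq:
  assumes "k \<in> {1..n}"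
  shows "denom_factor n q x \<pi> k = den_factor (\<pi> ` {1..<k})"
  unfolding denom_factor_def den_factor_def kappa_w0 kappa_entries card_prefix x_sum
  using assms by (simp add: of_nat_diff algebra_simps)

text \<open>No earlier letter lies below a left-to-right minimum, so its prefix may be replaced by
  the empty set, where K is 0.\<close>

lemma LRM_factor_eq:
  assumes "k \<in> LRM n \<pi>"
  shows "kappa q x [\<pi> k] = num_factor (\<pi> ` {1..<k}) (\<pi> k)"
proof -
  have "num_factor (\<pi> ` {1..<k}) (\<pi> k) = num_factor {} (\<pi> k)"
    using assms perm_notin_prefix by (intro num_factor_below) (auto simp: LRM_def)
  then show ?thesis
    by (simp add: kappa_eq num_factor_def kappa_set_def)
qed

text \<open>By minimality of \<open>first_smaller \<pi> k\<close> every letter before that position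
  exceeds \<open>\<pi> k\<close>, so \<open>num_factor_below\<close> extends the window to the whole
  prefix.\<close>

lemma non_LRM_factor_eq:
  assumes "k \<in> {1..n} - LRM n \<pi>"
  shows "non_LRM_factor q x \<pi> k = num_factor (\<pi> ` {1..<k}) (\<pi> k)"
proof -
  let ?p = "first_smaller \<pi> k"
  \<comment> \<open>Failing to be a left-to-right minimum only denies a strict inequality;
    injectivity of \<pi> makes the earlier letter strictly smaller, so the \<open>LEAST\<close> is
    attained.\<close>
  obtain i where "1 \<le> i" "i < k" "\<not> \<pi> k < \<pi> i"
    using assms by (auto simp: LRM_def)
  moreover from this have "\<pi> i \<noteq> \<pi> k"
    using injD[OF permutes_inj[OF perm], of i k] by auto
  ultimately have "\<exists>i. 1 \<le> i \<and> i < k \<and> \<pi> i < \<pi> k"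
    by (meson nat_neq_iff)
  then have "1 \<le> ?p \<and> ?p < k \<and> \<pi> ?p < \<pi> k"
    unfolding first_smaller_def by (rule LeastI_ex)
  then have p: "1 \<le> ?p" "?p < k" by auto
  have least: "?p \<le> i" if "1 \<le> i" "i < k" "\<pi> i < \<pi> k" for i
    unfolding first_smaller_def using that by (intro Least_le) auto
  have notin: "\<pi> k \<notin> \<pi> ` {?p..<k}"
    using perm_notin_prefix[of k] p by auto
  have "non_LRM_factor q x \<pi> k = num_factor (\<pi> ` {?p..<k}) (\<pi> k)"
    using p
    by (simp add: non_LRM_factor_def kappa_entries num_factor_def atLeastLessThanSuc
        divide_inverse mult.commute)
  also have "\<dots> = num_factor (\<pi> ` {1..<k}) (\<pi> k)"
  proof (rule num_factor_below)
    show "{c \<in> \<pi> ` {?p..<k}. c < \<pi> k} = {c \<in> \<pi> ` {1..<k}. c < \<pi> k}"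
      using p(1) least by (auto intro!: imageI)
  qed (use notin perm_notin_prefix in simp_all)
  finally show ?thesis .
qed

lemma inv_count_eq: "inv_count n \<pi> = (\<Sum>k=1..n. free_rank (\<pi> ` {1..<k}) (\<pi> k))"
proof -
  have row: "card {j\<in>{1..n}. k < j \<and> \<pi> j < \<pi> k} = free_rank (\<pi> ` {1..<k}) (\<pi> k)"
    if "k \<in> {1..n}" for k
  proof -
    have "\<pi> ` {j\<in>{1..n}. k < j \<and> \<pi> j < \<pi> k} = {b \<in> {1..n} - \<pi> ` {1..<k}. b < \<pi> k}"
    proof (intro equalityI subsetI)
      fix b assume "b \<in> \<pi> ` {j\<in>{1..n}. k < j \<and> \<pi> j < \<pi> k}"
      then obtain j where j: "b = \<pi> j" "j \<in> {1..n}" "k < j" "\<pi> j < \<pi> k" by blast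
      have "\<pi> j \<notin> \<pi> ` {1..<k}"
        using j injD[OF permutes_inj[OF perm], of j] by fastforce
      then show "b \<in> {b \<in> {1..n} - \<pi> ` {1..<k}. b < \<pi> k}"
        using j perm_in[of j] by simp
    next
      fix b assume b: "b \<in> {b \<in> {1..n} - \<pi> ` {1..<k}. b < \<pi> k}"
      then obtain j where j: "b = \<pi> j" "j \<in> {1..n}"
        using permutes_image[OF perm] by (metis (no_types, lifting) DiffD1 imageE mem_Collect_eq)
      have "\<not> j < k" "j \<noteq> k" using b j by auto
      then show "b \<in> \<pi> ` {j\<in>{1..n}. k < j \<and> \<pi> j < \<pi> k}"
        using b j by auto
    qed
    from this[symmetric] show ?thesis
      unfolding free_rank_def by (simp only: card_image[OF inj_perm])
  qed
  have "{(i, j). 1 \<le> i \<and> i < j \<and> j \<le> n \<and> \<pi> i > \<pi> j}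
      = (SIGMA k:{1..n}. {j\<in>{1..n}. k < j \<and> \<pi> j < \<pi> k})"
    by auto
  then show ?thesis
    unfolding inv_count_def using row by simp
qed

text \<open>\<open>Psi\<close> multiplies only up to n - 1, yet the factor at n may be appended,
  since its numerator and denominator agree by \<open>den_factor_last\<close>. The power of q is
  spread over the positions by \<open>inv_count_eq\<close>.\<close>

lemma Psi_eq: "Psi n q x \<pi> = (\<Prod>k=1..n. step_prob (\<pi> ` {1..<k}) (\<pi> k))"
proof -
  let ?N = "\<lambda>k. num_factor (\<pi> ` {1..<k}) (\<pi> k)"
  let ?D = "\<lambda>k. den_factor (\<pi> ` {1..<k})"
  have split: "{1..n} = insert n {1..n - 1}" "n \<notin> {1..n - 1}" using n_pos by auto
  have "insert (\<pi> n) (\<pi> ` {1..<n}) = {1..n}"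
    using prefix_Suc[OF n_pos] permutes_image[OF perm] by (simp add: atLeastLessThanSuc_atLeastAtMost)
  then have last: "?D n = ?N n"
    using perm_notin_prefix by (rule den_factor_last)
  have "?D n > 0"
    using prefix_subset[of n] n_pos by (intro den_factor_pos) auto
  have "(\<Prod>k \<in> {1..n - 1} \<inter> LRM n \<pi>. kappa q x [\<pi> k])
      * (\<Prod>k \<in> {1..n - 1} - LRM n \<pi>. non_LRM_factor q x \<pi> k)
      = (\<Prod>k \<in> {1..n - 1} \<inter> LRM n \<pi>. ?N k) * (\<Prod>k \<in> {1..n - 1} - LRM n \<pi>. ?N k)"
    by (intro arg_cong2[where f = "(*)"] prod.cong)
      (auto simp: LRM_factor_eq non_LRM_factor_eq simp del: One_nat_def)
  also have "\<dots> = (\<Prod>k=1..n - 1. ?N k)"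
    by (rule prod.Int_Diff[symmetric]) simp
  finally have num: "(\<Prod>k \<in> {1..n - 1} \<inter> LRM n \<pi>. kappa q x [\<pi> k])
      * (\<Prod>k \<in> {1..n - 1} - LRM n \<pi>. non_LRM_factor q x \<pi> k) = (\<Prod>k=1..n - 1. ?N k)" .
  have den: "(\<Prod>k=1..n - 1. denom_factor n q x \<pi> k) = (\<Prod>k=1..n - 1. ?D k)"
    by (intro prod.cong refl denom_factor_eq) auto
  have "(\<Prod>k=1..n. step_prob (\<pi> ` {1..<k}) (\<pi> k))
      = (\<Prod>k=1..n. ?N k) / (q ^ inv_count n \<pi> * (\<Prod>k=1..n. ?D k))"
    by (simp add: step_prob_def prod_dividef prod.distrib inv_count_eq power_sum)
  also have "\<dots> = (\<Prod>k=1..n - 1. ?N k) / (q ^ inv_count n \<pi> * (\<Prod>k=1..n - 1. ?D k))"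
    using split \<open>?D n > 0\<close> last by simp
  also have "\<dots> = Psi n q x \<pi>"
    unfolding Psi_def num den by (simp add: power_int_minus field_simps)
  finally show ?thesis by simp
qed

end

end

section \<open>Linearity and coefficients of the operators\<close>

lemma lin_ext_sum:
  "lin_ext n f (\<lambda>\<sigma>. \<Sum>i\<in>I. c i * u i \<sigma>) = (\<lambda>\<sigma>. \<Sum>i\<in>I. c i * lin_ext n f (u i) \<sigma>)"
proof
  fix \<sigma>
  have "lin_ext n f (\<lambda>\<sigma>. \<Sum>i\<in>I. c i * u i \<sigma>) \<sigma>
      = (\<Sum>\<pi>\<in>perms n. \<Sum>i\<in>I. c i * (u i \<pi> * f \<pi> \<sigma>))"
    by (simp add: lin_ext_def sum_distrib_right mult.assoc)
  also have "\<dots> = (\<Sum>i\<in>I. c i * lin_ext n f (u i) \<sigma>)"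
    by (subst sum.swap) (simp add: lin_ext_def sum_distrib_left)
  finally show "lin_ext n f (\<lambda>\<sigma>. \<Sum>i\<in>I. c i * u i \<sigma>) \<sigma> = (\<Sum>i\<in>I. c i * lin_ext n f (u i) \<sigma>)" .
qed

text \<open>Vectors carry meaning only on \<open>perms n\<close>, and \<open>lin_ext\<close> reads
  no other values; identities known for permutations alone can thus be used under an
  operator.\<close>

lemma lin_ext_cong:
  assumes "\<And>\<pi>. \<pi> \<in> perms n \<Longrightarrow> u \<pi> = v \<pi>"
  shows "lin_ext n f u = lin_ext n f v"
  unfolding lin_ext_def by (intro ext sum.cong refl) (simp add: assms)

lemma fold_hecke_T_sum:
  "fold (hecke_T n q) js (\<lambda>\<sigma>. \<Sum>i\<in>I. c i * u i \<sigma>)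
    = (\<lambda>\<sigma>. \<Sum>i\<in>I. c i * fold (hecke_T n q) js (u i) \<sigma>)"
proof (induction js arbitrary: u)
  case (Cons j js)
  show ?case
    unfolding fold_Cons comp_apply hecke_T_def[of n q j] lin_ext_sum Cons.IH ..
qed simp

lemma tsetlin_sum:
  "tsetlin n q x (\<lambda>\<sigma>. \<Sum>i\<in>I. c i * u i \<sigma>) \<sigma> = (\<Sum>i\<in>I. c i * tsetlin n q x (u i) \<sigma>)"
  unfolding tsetlin_def X_op_def fold_hecke_T_sum lin_ext_sum
  by (subst sum.swap) (simp add: sum_distrib_left)

lemma finite_perms: "finite (perms n)"
  by (simp add: finite_permutations)

lemma sum_basis_vec:
  assumes "\<sigma> \<in> perms n"
  shows "(\<Sum>\<pi>\<in>perms n. c \<pi> * basis_vec \<pi> \<sigma>) = c \<sigma>"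
proof -
  have "(\<Sum>\<pi>\<in>perms n. c \<pi> * basis_vec \<pi> \<sigma>) = (\<Sum>\<pi>\<in>perms n. if \<sigma> = \<pi> then c \<pi> else 0)"
    by (intro sum.cong) (auto simp: basis_vec_def)
  then show ?thesis using assms by (simp only: sum.delta'[OF finite_perms] if_True)
qed

lemma X_op_apply:
  assumes "\<sigma> \<in> perms n"
  shows "X_op n q x v \<sigma> = x (\<sigma> 1) / q ^ (n - \<sigma> 1) * v \<sigma>"
  using sum_basis_vec[OF assms, of "\<lambda>\<pi>. v \<pi> * (x (\<pi> 1) / q ^ (n - \<pi> 1))"]
  by (simp add: X_op_def lin_ext_def mult_ac)

lemma swap_pos_swap_pos: "swap_pos i (swap_pos i \<pi>) = \<pi>"
  by (simp add: swap_pos_def comp_assoc)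

lemma swap_pos_simps:
  "swap_pos i \<pi> i = \<pi> (i + 1)" "swap_pos i \<pi> (i + 1) = \<pi> i"
  "k \<noteq> i \<Longrightarrow> k \<noteq> i + 1 \<Longrightarrow> swap_pos i \<pi> k = \<pi> k"
  by (simp_all add: swap_pos_def)

lemma swap_pos_perms:
  assumes "\<pi> \<in> perms n" "i \<in> {1..<n}"
  shows "swap_pos i \<pi> \<in> perms n"
proof -
  have "transpose i (i + 1) permutes {1..n}"
    using assms(2) by (intro permutes_swap_id) auto
  then show ?thesis
    using assms(1) by (simp add: swap_pos_def permutes_compose)
qed

text \<open>Reading off coefficients transposes the action: the coefficient at \<sigma> is fed by
  \<sigma> and by \<open>swap_pos j \<sigma>\<close>. The latter has a descent at j exactly when
  \<sigma> has an ascent, which is why the factor q appears at ascents here.\<close>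

lemma hecke_T_apply:
  assumes \<sigma>: "\<sigma> \<in> perms n" and j: "j \<in> {1..<n}"
  shows "hecke_T n q j v \<sigma> = (if \<sigma> j < \<sigma> (j + 1) then q * v (swap_pos j \<sigma>) + (q - 1) * v \<sigma>
    else v (swap_pos j \<sigma>))"
proof -
  let ?c = "\<lambda>\<pi>. v \<pi> * (if \<pi> (j + 1) < \<pi> j then q else 1)"
  let ?d = "\<lambda>\<pi>. v \<pi> * (if \<pi> (j + 1) < \<pi> j then 0 else q - 1)"
  have neq: "\<sigma> j \<noteq> \<sigma> (j + 1)"
    using injD[OF permutes_inj, of \<sigma> "{1..n}" j "j + 1"] \<sigma> by auto
  have swap: "basis_vec (swap_pos j \<pi>) \<sigma> = basis_vec \<pi> (swap_pos j \<sigma>)" for \<pi>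
    unfolding basis_vec_def using swap_pos_swap_pos[of j \<sigma>] swap_pos_swap_pos[of j \<pi>] by auto
  have "hecke_T n q j v \<sigma>
      = (\<Sum>\<pi>\<in>perms n. ?c \<pi> * basis_vec \<pi> (swap_pos j \<sigma>) + ?d \<pi> * basis_vec \<pi> \<sigma>)"
    unfolding hecke_T_def lin_ext_def
    by (intro sum.cong refl) (simp add: swap algebra_simps)
  also have "\<dots> = ?c (swap_pos j \<sigma>) + ?d \<sigma>"
    unfolding sum.distrib sum_basis_vec[OF \<sigma>] sum_basis_vec[OF swap_pos_perms[OF \<sigma> j]] ..
  finally show ?thesis
    using neq swap_pos_simps(1,2)[of j \<sigma>] by auto
qed

section \<open>Total mass 1\<close>

lemma bij_betw_perms_lists:
  "bij_betw (\<lambda>\<pi>. map \<pi> [1..<Suc n]) (perms n) (permutations_of_set {1..n})"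
proof -
  let ?f = "\<lambda>\<pi>. map \<pi> [1..<Suc n]"
  have inj: "inj_on ?f (perms n)"
  proof (rule inj_onI)
    fix \<pi> \<sigma> assume *: "\<pi> \<in> perms n" "\<sigma> \<in> perms n" "?f \<pi> = ?f \<sigma>"
    have "\<pi> k = \<sigma> k" for k
    proof (cases "k \<in> {1..n}")
      case True
      then have "k \<in> set [1..<Suc n]" by auto
      then show ?thesis using *(3) by (metis map_eq_conv)
    next
      case False
      then show ?thesis using * by (simp add: permutes_not_in del: atLeastAtMost_iff)
    qed
    then show "\<pi> = \<sigma>" by auto
  qed
  \<comment> \<open>Surjectivity by counting: the image of an injective map lies in a finite set of
    the same cardinality n!.\<close>
  have "?f ` perms n = permutations_of_set {1..n}"
  proof (rule card_subset_eq)
    show "?f ` perms n \<subseteq> permutations_of_set {1..n}"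
    proof
      fix xs assume "xs \<in> ?f ` perms n"
      then obtain \<pi> where \<pi>: "\<pi> permutes {1..n}" "xs = ?f \<pi>" by blast
      have "set xs = {1..n}"
        using permutes_image[OF \<pi>(1)] \<pi>(2)
        by (simp add: atLeastLessThanSuc_atLeastAtMost del: upt_Suc)
      moreover have "distinct xs"
        using \<pi> permutes_inj_on[OF \<pi>(1)] by (simp add: distinct_map del: upt_Suc)
      ultimately show "xs \<in> permutations_of_set {1..n}" by blast
    qed
    show "card (?f ` perms n) = card (permutations_of_set {1..n})"
      unfolding card_image[OF inj] using card_permutations[of "{1..n}" n] by simp
  qed simp
  with inj show ?thesis by (simp only: bij_betw_def)
qed

context q_tsetlin
begin

text \<open>Lists allow the sampling to be peeled from the front: with the letters of
  \<open>P\<close> already used, the recursion separates the next letter from the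
  continuation.\<close>

primrec list_prob :: "nat set \<Rightarrow> nat list \<Rightarrow> real" where
  "list_prob P [] = 1"
| "list_prob P (a # as) = step_prob P a * list_prob (insert a P) as"

lemma sum_list_prob:
  assumes "P \<subseteq> {1..n}"
  shows "(\<Sum>as\<in>permutations_of_set ({1..n} - P). list_prob P as) = 1"
  using assms
proof (induction "card ({1..n} - P)" arbitrary: P)
  case 0
  then have "{1..n} - P = {}" by simp
  then show ?case by (simp only: permutations_of_set_empty) simp
next
  case (Suc m)
  let ?A = "{1..n} - P"
  have ne: "?A \<noteq> {}" using Suc.hyps(2) by (metis card.empty nat.distinct(1))
  have IH: "(\<Sum>as\<in>permutations_of_set (?A - {a}). list_prob (insert a P) as) = 1" if "a \<in> ?A" for a
  proof -
    have "{1..n} - insert a P = ?A - {a}" by blast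
    moreover have "card (?A - {a}) = m" using Suc.hyps(2) that by simp
    moreover have "insert a P \<subseteq> {1..n}" using that Suc.prems by blast
    ultimately show ?thesis using Suc.hyps(1)[of "insert a P"] by metis
  qed
  have "(\<Sum>as\<in>permutations_of_set ?A. list_prob P as)
      = (\<Sum>a\<in>?A. \<Sum>as\<in>(#) a ` permutations_of_set (?A - {a}). list_prob P as)"
    unfolding permutations_of_set_nonempty[OF ne]
    by (rule sum.UNION_disjoint) auto
  also have "\<dots> = (\<Sum>a\<in>?A. step_prob P a)"
  proof (rule sum.cong[OF refl])
    fix a assume a: "a \<in> ?A"
    have "(\<Sum>as\<in>(#) a ` permutations_of_set (?A - {a}). list_prob P as)
        = (\<Sum>as\<in>permutations_of_set (?A - {a}). step_prob P a * list_prob (insert a P) as)"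
      by (subst sum.reindex) simp_all
    also have "\<dots> = step_prob P a"
      unfolding sum_distrib_left[symmetric] IH[OF a] by simp
    finally show "(\<Sum>as\<in>(#) a ` permutations_of_set (?A - {a}). list_prob P as) = step_prob P a" .
  qed
  also have "\<dots> = 1"
    using ne Suc.prems by (intro sum_step_prob) blast
  finally show ?case .
qed

lemma list_prob_map:
  assumes "k \<ge> 1"
  shows "list_prob (\<pi> ` {1..<k}) (map \<pi> [k..<m]) = (\<Prod>i=k..<m. step_prob (\<pi> ` {1..<i}) (\<pi> i))"
  using assms
proof (induction "m - k" arbitrary: k)
  case (Suc d)
  then have "k < m" by simp
  have "\<pi> ` {1..<Suc k} = insert (\<pi> k) (\<pi> ` {1..<k})"
    using Suc.prems by (simp add: atLeastLessThanSuc)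
  then have "list_prob (\<pi> ` {1..<k}) (map \<pi> [k..<m])
      = step_prob (\<pi> ` {1..<k}) (\<pi> k) * list_prob (\<pi> ` {1..<Suc k}) (map \<pi> [Suc k..<m])"
    using \<open>k < m\<close> by (simp only: upt_conv_Cons list.map list_prob.simps)
  also have "\<dots> = step_prob (\<pi> ` {1..<k}) (\<pi> k)
      * (\<Prod>i=Suc k..<m. step_prob (\<pi> ` {1..<i}) (\<pi> i))"
    using Suc by (subst Suc.hyps(1)) auto
  also have "\<dots> = (\<Prod>i=k..<m. step_prob (\<pi> ` {1..<i}) (\<pi> i))"
    by (rule prod.atLeast_Suc_lessThan[OF \<open>k < m\<close>, symmetric])
  finally show ?case .
qed simp

lemma sum_Psi: "(\<Sum>\<pi>\<in>perms n. Psi n q x \<pi>) = 1"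
proof -
  have "Psi n q x \<pi> = list_prob {} (map \<pi> [1..<Suc n])" if "\<pi> \<in> perms n" for \<pi>
    using that list_prob_map[of 1 \<pi> "Suc n"]
    by (simp add: Psi_eq atLeastLessThanSuc_atLeastAtMost del: upt_Suc One_nat_def)
  then have "(\<Sum>\<pi>\<in>perms n. Psi n q x \<pi>) = (\<Sum>\<pi>\<in>perms n. list_prob {} (map \<pi> [1..<Suc n]))"
    by (rule sum.cong[OF refl])
  also have "\<dots> = (\<Sum>as\<in>permutations_of_set {1..n}. list_prob {} as)"
    by (rule sum.reindex_bij_betw[OF bij_betw_perms_lists])
  also have "\<dots> = 1"
    using sum_list_prob[of "{}"] by simp
  finally show ?thesis .
qed

section \<open>Partial Hecke sums and stationarity\<close>

definition tail_vec :: "nat \<Rightarrow> vec" where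
  "tail_vec j \<pi> = q ^ (n - j) / q ^ free_rank (\<pi> ` {1..<j}) (\<pi> j)
     * (\<Prod>k\<in>{1..n} - {j}. step_prob (\<pi> ` {1..<k}) (\<pi> k))"

text \<open>Both swapped positions lie inside the prefix or both outside it, unless the prefix ends
  exactly between j and j + 1.\<close>

lemma image_swap_pos:
  assumes "k \<noteq> j + 1" "j \<ge> 1"
  shows "swap_pos j \<pi> ` {1..<k} = \<pi> ` {1..<k}"
proof (cases "k \<le> j")
  case True
  then show ?thesis by (intro image_cong refl) (simp add: swap_pos_simps)
next
  case False
  have "transpose j (j + 1) permutes {1..<k}"
    using False assms by (intro permutes_swap_id) auto
  then show ?thesis
    unfolding swap_pos_def image_comp[symmetric] by (simp add: permutes_image)
qed

text \<open>\<sigma> and its swap share all factors at positions other than j and j + 1. Once this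
  common product \<open>rest\<close> is extracted, the claim is
  \<open>step_prob_swap\<close>.\<close>

lemma tail_vec_step:
  assumes \<sigma>: "\<sigma> permutes {1..n}" and j: "j \<in> {1..<n}"
  shows "tail_vec j \<sigma> = Psi n q x \<sigma> + hecke_T n q j (tail_vec (j + 1)) \<sigma>"
proof -
  define P where "P = \<sigma> ` {1..<j}"
  define a where "a = \<sigma> j"
  define b where "b = \<sigma> (j + 1)"
  define m where "m = n - j - 1"
  define \<tau> where "\<tau> = swap_pos j \<sigma>"
  let ?K = "{1..n} - {j} - {j + 1}"
  define rest where "rest = (\<Prod>k\<in>?K. step_prob (\<sigma> ` {1..<k}) (\<sigma> k))"
  have jj: "j \<ge> 1" "j \<le> n" "j + 1 \<in> {1..n} - {j}" "j \<in> {1..n} - {j + 1}" "j \<in> {1..n}"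
    using j by auto
  have nj: "n - j = Suc m" "n - (j + 1) = m" using j by (auto simp: m_def)
  have Kswap: "{1..n} - {j + 1} - {j} = ?K" by blast
  have Pa: "\<sigma> ` {1..<j + 1} = insert a P"
    using prefix_Suc[OF \<sigma> jj(1)] by (simp add: P_def a_def)
  have Pb: "\<tau> ` {1..<j + 1} = insert b P"
  proof -
    have "\<tau> ` {1..<j + 1} = insert (\<tau> j) (\<tau> ` {1..<j})"
      using jj(1) by (simp add: atLeastLessThanSuc)
    then show ?thesis
      using image_swap_pos[of j j \<sigma>] jj(1) by (simp add: \<tau>_def b_def P_def swap_pos_simps)
  qed
  have P\<tau>: "\<tau> ` {1..<j} = P"
    unfolding \<tau>_def P_def using jj(1) by (intro image_swap_pos) auto
  have \<tau>: "\<tau> j = b" "\<tau> (j + 1) = a"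
    by (simp_all only: \<tau>_def a_def b_def swap_pos_simps)
  have rest\<tau>: "(\<Prod>k\<in>?K. step_prob (\<tau> ` {1..<k}) (\<tau> k)) = rest"
    unfolding rest_def \<tau>_def
    by (intro prod.cong refl arg_cong2[where f = step_prob] image_swap_pos swap_pos_simps)
      (use jj(1) in auto)
  have 1: "tail_vec j \<sigma> = q ^ Suc m / q ^ free_rank P a * step_prob (insert a P) b * rest"
    unfolding tail_vec_def nj prod.remove[OF finite_Diff[OF finite_atLeastAtMost] jj(3)]
    by (simp only: Pa rest_def mult.assoc flip: P_def a_def b_def)
  have 2: "Psi n q x \<sigma> = step_prob P a * step_prob (insert a P) b * rest"
    unfolding Psi_eq[OF \<sigma>] prod.remove[OF finite_atLeastAtMost jj(5)]
      prod.remove[OF finite_Diff[OF finite_atLeastAtMost] jj(3)]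
    by (simp only: Pa rest_def mult.assoc flip: P_def a_def b_def)
  have 3: "tail_vec (j + 1) \<sigma> = q ^ m / q ^ free_rank (insert a P) b * step_prob P a * rest"
    unfolding tail_vec_def nj prod.remove[OF finite_Diff[OF finite_atLeastAtMost] jj(4)] Kswap
    by (simp only: Pa rest_def mult.assoc flip: P_def a_def b_def)
  have 4: "tail_vec (j + 1) \<tau> = q ^ m / q ^ free_rank (insert b P) a * step_prob P b * rest"
    unfolding tail_vec_def nj prod.remove[OF finite_Diff[OF finite_atLeastAtMost] jj(4)] Kswap
    by (simp only: Pb P\<tau> \<tau> rest\<tau> mult.assoc)
  have swap: "q ^ Suc m / q ^ free_rank P a * step_prob (insert a P) b
    = step_prob P a * step_prob (insert a P) b
      + (if a < b then q * (q ^ m / q ^ free_rank (insert b P) a * step_prob P b)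
            + (q - 1) * (q ^ m / q ^ free_rank (insert a P) b * step_prob P a)
         else q ^ m / q ^ free_rank (insert b P) a * step_prob P b)"
  proof (rule step_prob_swap)
    show "P \<subseteq> {1..n}" unfolding P_def using prefix_subset[OF \<sigma> jj(5)] by blast
    show "card P + Suc (Suc m) = n" unfolding P_def card_prefix[OF \<sigma>] m_def using j by auto
    show "a \<in> {1..n}" "b \<in> {1..n}"
      unfolding a_def b_def perm_in[OF \<sigma>] using jj by auto
    show "a \<notin> P" unfolding a_def P_def by (rule perm_notin_prefix[OF \<sigma>])
    have "b \<notin> insert a P" unfolding Pa[symmetric] b_def by (rule perm_notin_prefix[OF \<sigma>])
    then show "b \<notin> P" "a \<noteq> b" by auto
  qed
  have T: "hecke_T n q j (tail_vec (j + 1)) \<sigma>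
      = (if a < b then q * tail_vec (j + 1) \<tau> + (q - 1) * tail_vec (j + 1) \<sigma> else tail_vec (j + 1) \<tau>)"
    unfolding a_def b_def \<tau>_def using hecke_T_apply[of \<sigma> n j] \<sigma> j by simp
  show ?thesis
    unfolding T 1 2 3 4 swap by (simp only: distrib_right mult.assoc split: if_split) simp
qed

lemma tail_vec_last:
  assumes \<sigma>: "\<sigma> permutes {1..n}"
  shows "tail_vec n \<sigma> = Psi n q x \<sigma>"
proof -
  let ?P = "\<sigma> ` {1..<n}"
  have n: "n \<in> {1..n}" using n_pos by simp
  have full: "insert (\<sigma> n) ?P = {1..n}"
    using prefix_Suc[OF \<sigma> n_pos] permutes_image[OF \<sigma>]
    by (simp add: atLeastLessThanSuc_atLeastAtMost)
  have "{b \<in> {1..n} - ?P. b < \<sigma> n} = {}" unfolding full[symmetric] by blast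
  then have rank: "free_rank ?P (\<sigma> n) = 0" by (simp only: free_rank_def card.empty)
  have "step_prob ?P (\<sigma> n) = 1"
    using den_factor_last[OF full perm_notin_prefix[OF \<sigma>]] den_factor_pos[OF prefix_subset[OF \<sigma> n]]
    unfolding step_prob_def rank by simp
  then show ?thesis
    unfolding Psi_eq[OF \<sigma>] tail_vec_def rank prod.remove[OF finite_atLeastAtMost n] by simp
qed

text \<open>With nothing written yet, the step probability of a letter a is x_a.
  \<open>tail_vec 1\<close> has q^(n - 1) / q^(a - 1) = q^(n - a) in its place, and the coefficient
  of \<open>X_op\<close> turns this back into x_a.\<close>

lemma tail_vec_first:
  assumes \<sigma>: "\<sigma> permutes {1..n}"
  shows "x (\<sigma> 1) / q ^ (n - \<sigma> 1) * tail_vec 1 \<sigma> = Psi n q x \<sigma>"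
proof -
  have 1: "1 \<in> {1..n}" using n_pos by simp
  have s1: "\<sigma> 1 \<in> {1..n}" using perm_in[OF \<sigma>] 1 by blast
  have "{b \<in> {1..n} - {}. b < \<sigma> 1} = {1..<\<sigma> 1}" using s1 by auto
  then have rank: "free_rank {} (\<sigma> 1) = \<sigma> 1 - 1" by (simp add: free_rank_def)
  have exp: "int (\<sigma> 1) - 1 = int (\<sigma> 1 - 1)" using s1 by auto
  have "num_factor {} (\<sigma> 1) = x (\<sigma> 1) * q powi (int (\<sigma> 1) - 1)"
    by (simp add: num_factor_eq term_wt_def)
  then have "num_factor {} (\<sigma> 1) = x (\<sigma> 1) * q ^ (\<sigma> 1 - 1)"
    unfolding exp power_int_of_nat .
  then have step: "step_prob {} (\<sigma> 1) = x (\<sigma> 1)"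
    using q_pos unfolding step_prob_def rank by (simp add: den_factor_def kappa_set_def)
  have "n - 1 = (n - \<sigma> 1) + (\<sigma> 1 - 1)" using s1 by auto
  then have "q ^ (n - 1) = q ^ (n - \<sigma> 1) * q ^ (\<sigma> 1 - 1)" by (metis power_add)
  then show ?thesis
    unfolding Psi_eq[OF \<sigma>] tail_vec_def prod.remove[OF finite_atLeastAtMost 1]
    using q_pos by (simp add: rank step del: One_nat_def)
qed

text \<open>This identifies the closed form \<open>tail_vec\<close> with the partial sum Phi_j.
  Descending induction: the term i = j applies no operator and gives \<open>Psi\<close>; in every
  other term T_j is applied last, so it comes out of the sum by linearity.\<close>

lemma sum_fold_hecke_T:
  assumes v: "\<And>\<sigma>. \<sigma> \<in> perms n \<Longrightarrow> v \<sigma> = Psi n q x \<sigma>"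
    and "j \<ge> 1" "j \<le> n" "\<sigma> \<in> perms n"
  shows "(\<Sum>i=j..n. fold (hecke_T n q) (rev [j..<i]) v \<sigma>) = tail_vec j \<sigma>"
  using assms(3,4)
proof (induction arbitrary: \<sigma> rule: inc_induct)
  case base
  then show ?case using v tail_vec_last by simp
next
  case (step j)
  let ?F = "\<lambda>j i. fold (hecke_T n q) (rev [j..<i]) v"
  have j: "j \<in> {1..<n}" using step.hyps assms(2) by auto
  have "?F j i = hecke_T n q j (?F (Suc j) i)" if "i \<in> {Suc j..n}" for i
    using that by (simp add: upt_conv_Cons)
  then have "(\<Sum>i=Suc j..n. ?F j i \<sigma>) = (\<Sum>i=Suc j..n. hecke_T n q j (?F (Suc j) i) \<sigma>)"
    by (intro sum.cong) simp_all
  also have "\<dots> = hecke_T n q j (\<lambda>\<sigma>. \<Sum>i=Suc j..n. ?F (Suc j) i \<sigma>) \<sigma>"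
    using lin_ext_sum[where I = "{Suc j..n}" and c = "\<lambda>_. 1" and u = "?F (Suc j)"]
    by (simp add: hecke_T_def)
  \<comment> \<open>The induction hypothesis holds on permutations only, which suffices by
    \<open>lin_ext_cong\<close>.\<close>
  also have "\<dots> = hecke_T n q j (tail_vec (j + 1)) \<sigma>"
    unfolding hecke_T_def[of n q j] using step.IH by (intro fun_cong[OF lin_ext_cong]) simp
  finally have "(\<Sum>i=j..n. ?F j i \<sigma>) = Psi n q x \<sigma> + hecke_T n q j (tail_vec (j + 1)) \<sigma>"
    using j v[OF step.prems] by (simp add: sum.atLeast_Suc_atMost)
  then show ?case using tail_vec_step[of \<sigma> j] j step.prems by simp
qed

lemma Psi_stationary:
  assumes \<sigma>: "\<sigma> \<in> perms n"
  shows "(\<Sum>\<pi>\<in>perms n. Psi n q x \<pi> * tsetlin_matrix n q x \<pi> \<sigma>) = Psi n q x \<sigma>"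
proof -
  \<comment> \<open>\<open>v\<close> agrees with \<open>Psi\<close> on \<open>perms n\<close> and
    vanishes elsewhere; as a combination of basis vectors it lets \<open>tsetlin_sum\<close> turn
    the matrix product into the operator.\<close>
  define v where "v = (\<lambda>\<sigma>. \<Sum>\<pi>\<in>perms n. Psi n q x \<pi> * basis_vec \<pi> \<sigma>)"
  have v: "v \<tau> = Psi n q x \<tau>" if "\<tau> \<in> perms n" for \<tau>
    unfolding v_def by (rule sum_basis_vec[OF that])
  have "(\<Sum>\<pi>\<in>perms n. Psi n q x \<pi> * tsetlin_matrix n q x \<pi> \<sigma>) = tsetlin n q x v \<sigma>"
    unfolding tsetlin_matrix_def v_def tsetlin_sum ..
  also have "\<dots> = x (\<sigma> 1) / q ^ (n - \<sigma> 1)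
      * (\<Sum>i=1..n. fold (hecke_T n q) (rev [1..<i]) v \<sigma>)"
    unfolding tsetlin_def X_op_apply[OF \<sigma>] sum_distrib_left ..
  also have "\<dots> = Psi n q x \<sigma>"
    using tail_vec_first \<sigma> by (subst sum_fold_hecke_T[OF v _ n_pos \<sigma>]) auto
  finally show ?thesis .
qed

end

theorem theorem2p6:
  fixes n :: nat and q :: real and x :: "nat \<Rightarrow> real"
  assumes "n \<ge> 1" and "q \<ge> 1"
    and "\<And>i. i \<in> {1..n} \<Longrightarrow> x i > 0"
    and "(\<Sum>i=1..n. x i) = 1"
  shows "(\<forall>\<sigma>\<in>perms n. (\<Sum>\<pi>\<in>perms n. Psi n q x \<pi> * tsetlin_matrix n q x \<pi> \<sigma>)
            = (\<Sum>i=1..n. x i) * Psi n q x \<sigma>)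
       \<and> (\<forall>\<pi>\<in>perms n.
            q powi (- int (inv_count n \<pi>)) > 0
          \<and> (\<forall>k\<in>{1..n - 1}. denom_factor n q x \<pi> k > 0)
          \<and> (\<forall>k\<in>{1..n - 1} \<inter> LRM n \<pi>. kappa q x [\<pi> k] > 0)
          \<and> (\<forall>k\<in>{1..n - 1} - LRM n \<pi>. non_LRM_factor q x \<pi> k > 0))
       \<and> (\<Sum>\<pi>\<in>perms n. Psi n q x \<pi>) = 1"
proof -
  interpret q_tsetlin n q x using assms by unfold_locales
  \<comment> \<open>Both kinds of numerator factor have this form, so one positivity statement
    serves for both.\<close>
  have num_pos: "num_factor (\<pi> ` {1..<k}) (\<pi> k) > 0"
    if "\<pi> permutes {1..n}" "k \<in> {1..n - 1}" for \<pi> k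
  proof (rule num_factor_pos)
    have k: "k \<in> {1..n}" using that(2) by auto
    show "\<pi> ` {1..<k} \<subseteq> {1..n}" using prefix_subset[OF that(1) k] by (rule psubset_imp_subset)
    show "\<pi> k \<in> {1..n}" using perm_in[OF that(1)] k by blast
    show "\<pi> k \<notin> \<pi> ` {1..<k}" by (rule perm_notin_prefix[OF that(1)])
  qed
  show ?thesis
  proof (intro conjI ballI)
    fix \<sigma> assume "\<sigma> \<in> perms n"
    then show "(\<Sum>\<pi>\<in>perms n. Psi n q x \<pi> * tsetlin_matrix n q x \<pi> \<sigma>)
        = (\<Sum>i=1..n. x i) * Psi n q x \<sigma>"
      using Psi_stationary x_sum by simp
  next
    fix \<pi> k assume \<pi>: "\<pi> \<in> perms n" and k: "k \<in> {1..n - 1}"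
    then have "k \<in> {1..n}" by auto
    then show "denom_factor n q x \<pi> k > 0"
      using \<pi> den_factor_pos prefix_subset by (simp add: denom_factor_eq del: One_nat_def)
  next
    fix \<pi> k assume "\<pi> \<in> perms n" "k \<in> {1..n - 1} \<inter> LRM n \<pi>"
    then show "kappa q x [\<pi> k] > 0"
      using num_pos[of \<pi> k] LRM_factor_eq[of \<pi> k] by auto
  next
    fix \<pi> k assume \<pi>: "\<pi> \<in> perms n" and k: "k \<in> {1..n - 1} - LRM n \<pi>"
    then have "k \<in> {1..n} - LRM n \<pi>" by auto
    then show "non_LRM_factor q x \<pi> k > 0"
      using \<pi> k num_pos[of \<pi> k] non_LRM_factor_eq[of \<pi> k] by auto
  qed (use q_pos sum_Psi in simp_all)
qed

end
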